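(* Let $\pi$ be a permutation that avoids $231$. Then for every finite point set $P\subset[0,1]^2$ in general position that avoids both $231$ and $\pi$, we have $\mathrm{TSP}(P)\le 12|\pi|$.
   Context: A finite point set is in general position if no two points share an $x$- or $y$-coordinate. Such a set corresponds to the permutation obtained by listing its points by increasing $x$-coordinate and recording the ranks of their $y$-coordinates; the set avoids a permutation $\sigma$ if this permutation has no (not necessarily contiguous) subsequence order-isomorphic to $\sigma$ (i.e. with the same relative order of entries). $231$ is the permutation $(2,3,1)$, $|\pi|$ is the length of $\pi$. $\mathrm{TSP}(P)$ denotes the minimum Euclidean length of a closed tour visiting all points of $P$. *)

theory Defs
  imports
    "HOL-Analysis.Analysis"
    "HOL-Library.Sublist"
    "HOL-Combinatorics.Multiset_Permutations"
begin

text \<open>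
  Permutations are written in one-line notation, as lists over \<open>{1..n}\<close>; so \<open>231\<close> is \<open>[2, 3, 1]\<close>.
\<close>

definition is_permutation :: "nat list \<Rightarrow> bool" where
  "is_permutation \<sigma> \<longleftrightarrow> \<sigma> \<in> permutations_of_set {1..length \<sigma>}"

definition order_isomorphic :: "nat list \<Rightarrow> nat list \<Rightarrow> bool" where
  "order_isomorphic xs ys \<longleftrightarrow> length xs = length ys \<and>
     (\<forall>i<length xs. \<forall>j<length xs. xs ! i < xs ! j \<longleftrightarrow> ys ! i < ys ! j)"

definition avoids :: "nat list \<Rightarrow> nat list \<Rightarrow> bool" where
  "avoids \<tau> \<sigma> \<longleftrightarrow> \<not> (\<exists>xs. subseq xs \<tau> \<and> order_isomorphic xs \<sigma>)"

definition general_position :: "(real \<times> real) set \<Rightarrow> bool" where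
  "general_position P \<longleftrightarrow>
     (\<forall>p\<in>P. \<forall>q\<in>P. p \<noteq> q \<longrightarrow> fst p \<noteq> fst q \<and> snd p \<noteq> snd q)"

text \<open>
  The two definitions below are only meaningful for a finite set in general position:
  then \<open>sorted_key_list_of_set fst P\<close> lists the points of \<open>P\<close> by increasing \<open>x\<close>-coordinate,
  and the entry computed for \<open>p\<close> is the rank of its \<open>y\<close>-coordinate, the lowest point
  having rank \<open>1\<close>.
\<close>

definition perm_of :: "(real \<times> real) set \<Rightarrow> nat list" where
  "perm_of P = map (\<lambda>p. card {q \<in> P. snd q \<le> snd p}) (sorted_key_list_of_set fst P)"

definition set_avoids :: "(real \<times> real) set \<Rightarrow> nat list \<Rightarrow> bool" where
  "set_avoids P \<sigma> \<longleftrightarrow> avoids (perm_of P) \<sigma>"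

text \<open>
  A closed tour is given by the cyclic order in which it visits the points: the index
  modulo the length adds the closing edge. The distance on \<open>real \<times> real\<close> is the Euclidean one.
\<close>

definition tour_length :: "(real \<times> real) list \<Rightarrow> real" where
  "tour_length ps = (\<Sum>i<length ps. dist (ps ! i) (ps ! (Suc i mod length ps)))"

definition TSP :: "(real \<times> real) set \<Rightarrow> real" where
  "TSP P = Min (tour_length ` permutations_of_set P)"

lemma (in linorder) sorted_key_list_of_set_inj_on:
  assumes "finite A" "inj_on f A"
  shows "set (sorted_key_list_of_set f A) = A"
    and "distinct (map f (sorted_key_list_of_set f A))"
    and "sorted (map f (sorted_key_list_of_set f A))"
proof -
  interpret folding_insort_key "(\<le>)" "(<)" A f
    using assms(2) by unfold_locales
  show "set (sorted_key_list_of_set f A) = A"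
    by (rule set_sorted_key_list_of_set[OF subset_refl assms(1)])
  show "distinct (map f (sorted_key_list_of_set f A))"
    by (rule distinct_sorted_key_list_of_set[OF subset_refl])
  show "sorted (map f (sorted_key_list_of_set f A))"
    by (rule sorted_sorted_key_list_of_set[OF subset_refl])
qed

lemma sorted_key_list_of_general_position:
  assumes "finite P" "general_position P"
  shows "set (sorted_key_list_of_set fst P) = P"
    and "distinct (sorted_key_list_of_set fst P)"
    and "sorted (map fst (sorted_key_list_of_set fst P))"
proof -
  have "inj_on fst P"
    using assms(2) unfolding general_position_def inj_on_def by blast
  note L = sorted_key_list_of_set_inj_on[OF assms(1) this]
  show "set (sorted_key_list_of_set fst P) = P"
    "sorted (map fst (sorted_key_list_of_set fst P))"
    by (rule L)+
  show "distinct (sorted_key_list_of_set fst P)"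
    using L(2) by (simp add: distinct_map)
qed

lemma is_permutation_perm_of:
  assumes "finite P" "general_position P"
  shows "is_permutation (perm_of P)"
proof -
  let ?L = "sorted_key_list_of_set fst P"
  let ?r = "\<lambda>p. card {q \<in> P. snd q \<le> snd p}"
  note L = sorted_key_list_of_general_position[OF assms]
  have len: "length (perm_of P) = card P"
    using L distinct_card[of ?L] by (simp add: perm_of_def)
  have less: "?r p < ?r q" if "p \<in> P" "q \<in> P" "snd p < snd q" for p q
  proof (intro psubset_card_mono psubsetI)
    show "finite {q' \<in> P. snd q' \<le> snd q}" using assms(1) by simp
    show "{q' \<in> P. snd q' \<le> snd p} \<subseteq> {q' \<in> P. snd q' \<le> snd q}"
      using that by auto
    have "q \<in> {q' \<in> P. snd q' \<le> snd q}" "q \<notin> {q' \<in> P. snd q' \<le> snd p}"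
      using that by auto
    then show "{q' \<in> P. snd q' \<le> snd p} \<noteq> {q' \<in> P. snd q' \<le> snd q}"
      by blast
  qed
  have inj: "inj_on ?r P"
  proof (rule inj_onI, rule ccontr)
    fix p q assume "p \<in> P" "q \<in> P" "?r p = ?r q" "p \<noteq> q"
    moreover from this have "snd p \<noteq> snd q"
      using assms(2) unfolding general_position_def by blast
    ultimately show False
      using less[of p q] less[of q p] by linarith
  qed
  have "?r ` P \<subseteq> {1..card P}"
  proof (rule image_subsetI)
    fix p assume "p \<in> P"
    then have "{q \<in> P. snd q \<le> snd p} \<noteq> {}" by blast
    then have "?r p > 0" using assms(1) by (simp add: card_gt_0_iff)
    moreover have "?r p \<le> card P" using assms(1) by (intro card_mono) auto
    ultimately show "?r p \<in> {1..card P}" by simp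
  qed
  then have "?r ` P = {1..card P}"
    using card_image[OF inj] by (intro card_subset_eq) auto
  then show ?thesis
    using L inj unfolding is_permutation_def len permutations_of_set_def
    by (simp add: perm_of_def distinct_map)
qed

end

theory Submission
  imports Defs
begin

text \<open>
  The first entry of a \<open>231\<close>-avoiding pattern splits it as \<open>f # \<rho> @ \<tau>\<close> with \<open>\<rho> < f < \<tau>\<close>, and the
  leftmost point \<open>m\<close> of a \<open>231\<close>-avoiding point set splits the rest into \<open>A\<close> (below \<open>m\<close>) and \<open>B\<close>
  (above \<open>m\<close>), with \<open>A\<close> to the left of \<open>B\<close>. If the set avoids \<open>f # \<rho> @ \<tau>\<close>, then either \<open>A\<close> avoids
  \<open>\<rho>\<close>, or \<open>B\<close> avoids \<open>\<tau>\<close>. Splitting the remaining one of \<open>B\<close> and \<open>A\<close> repeatedly, the points \<open>m\<close> of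
  the first kind form an increasing chain, those of the second kind form a decreasing chain, and
  the parts that avoid \<open>\<rho>\<close> or \<open>\<tau>\<close> lie in boxes arranged along an increasing diagonal. So in a box
  of half-perimeter \<open>s\<close>, where such a part has a path of length \<open>4 (|\<pi>| - 1) s\<close> between opposite
  corners by induction, these parts together also have one, and both chains are collected at an
  additional cost of \<open>4 s\<close>.
\<close>

section \<open>Polygonal paths and closed tours\<close>

fun polyline_length :: "'a::metric_space list \<Rightarrow> real" where
  "polyline_length (p # q # ps) = dist p q + polyline_length (q # ps)"
| "polyline_length _ = 0"

lemma polyline_length_append:
  "polyline_length (ps @ q # rs) = polyline_length (ps @ [q]) + polyline_length (q # rs)"
  by (induction ps rule: polyline_length.induct) (cases rs; simp)+

lemma polyline_length_drop_second: "polyline_length (p # ps) \<le> dist p q + polyline_length (q # ps)"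
  by (cases ps) (use dist_triangle in auto)

text \<open>Triangle inequality, one skipped point at a time. The head \<open>a\<close> varies in
  the induction because it becomes the last point kept; \<open>bs\<close> leaves room for a closing
  point.\<close>

lemma polyline_length_Cons_mono:
  assumes "subseq ps qs"
  shows "polyline_length (a # ps @ bs) \<le> polyline_length (a # qs @ bs)"
  using assms
proof (induction arbitrary: a rule: list_emb.induct)
  case (list_emb_Nil ys)
  show ?case
  proof (induction ys arbitrary: a)
    case (Cons y ys)
    have "polyline_length (a # bs) \<le> dist a y + polyline_length (y # bs)"
      by (rule polyline_length_drop_second)
    also have "\<dots> \<le> dist a y + polyline_length (y # ys @ bs)"
      using Cons.IH[of y] by simp
    finally show ?case by simp
  qed simp
next
  case (list_emb_Cons xs ys y)
  have "polyline_length (a # xs @ bs) \<le> dist a y + polyline_length (y # xs @ bs)"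
    by (rule polyline_length_drop_second)
  also have "\<dots> \<le> dist a y + polyline_length (y # ys @ bs)"
    using list_emb_Cons.IH[of y] by simp
  finally show ?case by simp
qed simp

lemma polyline_length_conv_sum:
  "polyline_length ps = (\<Sum>i<length ps - 1. dist (ps ! i) (ps ! Suc i))"
  by (induction ps rule: polyline_length.induct) (simp_all add: sum.lessThan_Suc_shift del: sum.lessThan_Suc)

lemma tour_length_Cons: "tour_length (p # ps) = polyline_length (p # ps @ [p])"
proof -
  have "(p # ps) ! (Suc i mod length (p # ps)) = (p # ps @ [p]) ! Suc i"
    if "i < length (p # ps)" for i
    using that by (cases "i = length ps") (auto simp: nth_append)
  moreover have "(p # ps) ! i = (p # ps @ [p]) ! i" if "i < length (p # ps)" for i
    using that by (cases i) (auto simp: nth_append)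
  ultimately show ?thesis
    unfolding tour_length_def polyline_length_conv_sum
    by (intro sum.cong) auto
qed

lemma tour_length_le_closed_polyline: "tour_length ps \<le> polyline_length (a # ps @ [a])"
proof (cases ps)
  case Nil
  then show ?thesis by (simp add: tour_length_def)
next
  case (Cons p qs)
  have "tour_length ps = polyline_length ((p # qs) @ [p])"
    unfolding Cons by (simp add: tour_length_Cons)
  also have "\<dots> \<le> polyline_length ((p # qs) @ [a, p])"
    using polyline_length_Cons_mono[of "qs @ [p]" "qs @ [a, p]" p "[]"]
    by (simp add: list_emb_append_mono)
  \<comment> \<open>Both sides are the same closed curve, cut open at \<open>p\<close> and at
    \<open>a\<close>.\<close>
  also have "\<dots> = polyline_length (a # ps @ [a])"
    using polyline_length_append[of "p # qs" a "[p]"] by (simp add: Cons dist_commute)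
  finally show ?thesis .
qed

text \<open>The list may repeat points and pass through points outside \<open>S\<close>, such as
  corners of boxes. Paths can then be concatenated freely, and the surplus is removed only once, in
  \<open>TSP_le_connects\<close>.\<close>

definition connects :: "'a::metric_space \<Rightarrow> 'a \<Rightarrow> 'a set \<Rightarrow> real \<Rightarrow> bool" where
  "connects a b S l \<longleftrightarrow> (\<exists>ps. S \<subseteq> set ps \<and> polyline_length (a # ps @ [b]) \<le> l)"

lemma connects_direct: "dist a b \<le> l \<Longrightarrow> connects a b {} l"
  unfolding connects_def by (intro exI[of _ "[]"]) simp

text \<open>The junction \<open>b\<close> counts as visited; this is how the chains below pick up
  their points.\<close>

lemma connects_trans:
  assumes "connects a b S l" "connects b c T l'"
  shows "connects a c (insert b (S \<union> T)) (l + l')"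
proof -
  obtain ps qs where "S \<subseteq> set ps" "polyline_length (a # ps @ [b]) \<le> l"
    "T \<subseteq> set qs" "polyline_length (b # qs @ [c]) \<le> l'"
    using assms unfolding connects_def by blast
  then show ?thesis
    unfolding connects_def using polyline_length_append[of "a # ps" b "qs @ [c]"]
    by (intro exI[of _ "ps @ b # qs"]) auto
qed

lemma connects_mono: "connects a b S l \<Longrightarrow> T \<subseteq> S \<Longrightarrow> l \<le> l' \<Longrightarrow> connects a b T l'"
  unfolding connects_def by fastforce

lemma subseq_remdups: "subseq (remdups xs) xs"
  by (induction xs) auto

text \<open>Shortcutting: repetitions, points outside \<open>P\<close> and finally the base point
  \<open>a\<close> are dropped, none of which lengthens the curve.\<close>

lemma TSP_le_connects:
  assumes "finite P" "connects a a P l"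
  shows "TSP P \<le> l"
proof -
  obtain qs where qs: "P \<subseteq> set qs" "polyline_length (a # qs @ [a]) \<le> l"
    using assms(2) unfolding connects_def by blast
  define ps where "ps = remdups (filter (\<lambda>p. p \<in> P) qs)"
  have "subseq ps (filter (\<lambda>p. p \<in> P) qs)"
    unfolding ps_def by (rule subseq_remdups)
  then have sub: "subseq ps qs"
    using subseq_filter_left subseq_order.trans by blast
  have "ps \<in> permutations_of_set P"
    using qs(1) unfolding ps_def permutations_of_set_def by auto
  then have "TSP P \<le> tour_length ps"
    unfolding TSP_def using assms(1) by (intro Min_le) auto
  also have "\<dots> \<le> polyline_length (a # ps @ [a])"
    by (rule tour_length_le_closed_polyline)
  also have "\<dots> \<le> polyline_length (a # qs @ [a])"
    by (rule polyline_length_Cons_mono[OF sub])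
  finally show ?thesis using qs(2) by simp
qed

text \<open>The l1 bound is additive along coordinatewise monotone paths, so such a path between
  opposite corners of a box is bounded by the half-perimeter, however many pieces it has.\<close>

lemma dist_Pair_le_abs:
  fixes a b c d :: real
  shows "dist (a, b) (c, d) \<le> \<bar>a - c\<bar> + \<bar>b - d\<bar>"
  using sqrt_sum_squares_le_sum_abs[of "a - c" "b - d"]
  by (simp add: dist_Pair_Pair dist_real_def)

section \<open>Pattern occurrences in point sets\<close>

text \<open>
  An occurrence of a pattern with distinct entries is given by the map \<open>g\<close> from the entries, rather
  than the positions, to the points; occurrences in disjoint ranges of entries are then glued by
  a case distinction.
\<close>

definition occurs_in :: "nat list \<Rightarrow> (real \<times> real) set \<Rightarrow> bool" where
  "occurs_in \<sigma> P \<longleftrightarrow> (\<exists>g. g ` set \<sigma> \<subseteq> P \<and> strict_mono_on (set \<sigma>) (snd \<circ> g) \<and>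
     sorted_wrt (\<lambda>k l. fst (g k) < fst (g l)) \<sigma>)"

lemma occurs_in_mono: "occurs_in \<sigma> P \<Longrightarrow> P \<subseteq> Q \<Longrightarrow> occurs_in \<sigma> Q"
  unfolding occurs_in_def by blast

lemma general_position_subset: "general_position P \<Longrightarrow> Q \<subseteq> P \<Longrightarrow> general_position Q"
  unfolding general_position_def by blast

lemma occurs_in_231:
  assumes "p \<in> P" "q \<in> P" "r \<in> P" "fst p < fst q" "fst q < fst r" "snd r < snd p" "snd p < snd q"
  shows "occurs_in [2, 3, 1] P"
  unfolding occurs_in_def
  by (rule exI[of _ "\<lambda>n::nat. if n = 2 then p else if n = 3 then q else r"])
    (use assms in \<open>auto simp: strict_mono_on_def\<close>)

lemma subseq_sorted_list:
  fixes f :: "'a \<Rightarrow> 'b::linorder"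
  assumes "sorted_wrt (<) (map f xs)" "sorted_wrt (<) (map f ys)" "set xs \<subseteq> set ys"
  shows "subseq xs ys"
  using assms
proof (induction ys arbitrary: xs)
  case (Cons y ys)
  show ?case
  proof (cases xs)
    case Cons': (Cons x xs')
    have less: "f x < f z" if "z \<in> set xs'" for z
      using Cons.prems(1) that unfolding Cons' by auto
    show ?thesis
    proof (cases "x = y")
      case True
      then have "set xs' \<subseteq> set ys"
        using less Cons.prems(3) unfolding Cons' by fastforce
      then show ?thesis
        using Cons.IH[of xs'] Cons.prems(1,2) unfolding Cons' True by simp
    next
      case False
      then have "x \<in> set ys" using Cons.prems(3) unfolding Cons' by simp
      then have "f y < f x" using Cons.prems(2) by auto
      then have "y \<notin> set xs" using less unfolding Cons' by force
      then have "set xs \<subseteq> set ys" using Cons.prems(3) by auto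
      then show ?thesis
        using Cons.IH[of xs] Cons.prems(1,2) by (simp add: list_emb_Cons)
    qed
  qed simp
qed simp

text \<open>Ranks of y-coordinates are ordered like the y-coordinates, and points sorted by x form a
  subsequence of the sorted list of \<open>P\<close>; so the entries of \<open>perm_of P\<close> at
  the points \<open>g k\<close> are a copy of \<open>\<sigma>\<close>.\<close>

lemma not_set_avoids_if_occurs_in:
  assumes "finite P" "general_position P" "occurs_in \<sigma> P"
  shows "\<not> set_avoids P \<sigma>"
proof -
  let ?L = "sorted_key_list_of_set fst P"
  let ?r = "\<lambda>p. card {q \<in> P. snd q \<le> snd p}"
  note L = sorted_key_list_of_general_position[OF assms(1,2)]
  obtain g where g: "g ` set \<sigma> \<subseteq> P" "strict_mono_on (set \<sigma>) (snd \<circ> g)"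
    "sorted_wrt (\<lambda>k l. fst (g k) < fst (g l)) \<sigma>"
    using assms(3) unfolding occurs_in_def by blast
  have "inj_on fst P"
    using assms(2) unfolding general_position_def inj_on_def by blast
  then have "sorted_wrt (<) (map fst ?L)"
    using L by (simp add: strict_sorted_iff distinct_map)
  then have "subseq (map g \<sigma>) ?L"
    using g L(1) by (intro subseq_sorted_list[of fst]) (auto simp: sorted_wrt_map)
  then have "subseq (map ?r (map g \<sigma>)) (perm_of P)"
    unfolding perm_of_def by (rule subseq_map)
  moreover have "order_isomorphic (map ?r (map g \<sigma>)) \<sigma>"
  proof -
    have mono: "?r p \<le> ?r q" if "snd p \<le> snd q" for p q :: "real \<times> real"
      using assms(1) that by (intro card_mono) auto
    have strict: "?r p < ?r q" if "q \<in> P" "snd p < snd q" for p q :: "real \<times> real"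
      using assms(1) that by (intro psubset_card_mono) force+
    have "?r (g k) < ?r (g l) \<longleftrightarrow> k < l" if kl: "k \<in> set \<sigma>" "l \<in> set \<sigma>" for k l
    proof (cases "k < l")
      case True
      then have "snd (g k) < snd (g l)" using g(2) kl by (auto simp: strict_mono_on_def)
      then show ?thesis using strict g(1) kl True by blast
    next
      case False
      then have "snd (g l) \<le> snd (g k)"
        using g(2) kl by (cases "l = k") (auto simp: strict_mono_on_def intro: less_imp_le)
      from mono[OF this] show ?thesis using False by simp
    qed
    then show ?thesis unfolding order_isomorphic_def by simp
  qed
  ultimately show ?thesis unfolding set_avoids_def avoids_def by blast
qed

section \<open>Splitting 231-avoiding patterns and point sets\<close>

lemma avoids_subseq: "avoids \<tau> \<sigma> \<Longrightarrow> subseq \<tau>' \<tau> \<Longrightarrow> avoids \<tau>' \<sigma>"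
  unfolding avoids_def using subseq_order.trans by blast

text \<open>An entry \<open>g\<close> above \<open>f\<close> followed by an entry \<open>k\<close>
  below \<open>f\<close> would make \<open>f\<close>, \<open>g\<close>, \<open>k\<close> a
  231.\<close>

lemma avoids_231_split_first:
  assumes "distinct (f # \<sigma>)" "avoids (f # \<sigma>) [2, 3, 1]"
  obtains \<rho> \<tau> where "\<sigma> = \<rho> @ \<tau>" "\<forall>k\<in>set \<rho>. k < f" "\<forall>k\<in>set \<tau>. f < k"
proof -
  let ?\<rho> = "takeWhile (\<lambda>k. k < f) \<sigma>" and ?\<tau> = "dropWhile (\<lambda>k. k < f) \<sigma>"
  have "f < k" if k: "k \<in> set ?\<tau>" for k
  proof (rule ccontr)
    assume "\<not> f < k"
    moreover have "k \<noteq> f" using assms(1) k set_dropWhileD by force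
    ultimately have "k < f" by simp
    obtain g \<tau>' where \<tau>': "?\<tau> = g # \<tau>'" using k by (cases ?\<tau>) auto
    have "\<not> g < f" using hd_dropWhile[of "\<lambda>k. k < f" \<sigma>] \<tau>' by auto
    moreover have "g \<in> set ?\<tau>" using \<tau>' by simp
    then have "g \<noteq> f" using assms(1) set_dropWhileD by force
    ultimately have "f < g" by simp
    have "k \<in> set \<tau>'" using k \<open>k < f\<close> \<open>f < g\<close> unfolding \<tau>' by auto
    then have "subseq [g, k] ?\<tau>" unfolding \<tau>' by (simp add: subseq_singleton_left)
    moreover have "subseq ?\<tau> \<sigma>"
      by (metis suffix_dropWhile suffix_imp_subseq)
    ultimately have "subseq [f, g, k] (f # \<sigma>)"
      using subseq_order.trans by auto
    moreover have "order_isomorphic [f, g, k] [2, 3, 1]"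
      using \<open>k < f\<close> \<open>f < g\<close> unfolding order_isomorphic_def
      by (auto simp: less_Suc_eq numeral_3_eq_3)
    ultimately show False using assms(2) unfolding avoids_def by blast
  qed
  moreover have "\<forall>k\<in>set ?\<rho>. k < f" by (auto dest: set_takeWhileD)
  ultimately show ?thesis using that[of ?\<rho> ?\<tau>] by simp
qed

lemma occurs_in_glue:
  assumes "occurs_in \<rho> A" "occurs_in \<tau> B" "A \<subseteq> P" "B \<subseteq> P" "m \<in> P"
    and "\<forall>k\<in>set \<rho>. k < f" "\<forall>k\<in>set \<tau>. f < k"
    and "\<forall>p\<in>A. fst m < fst p \<and> snd p < snd m" "\<forall>p\<in>B. fst m < fst p \<and> snd m < snd p"
    and "\<forall>p\<in>A. \<forall>q\<in>B. fst p < fst q"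
  shows "occurs_in (f # \<rho> @ \<tau>) P"
proof -
  obtain g h where g: "g ` set \<rho> \<subseteq> A" "strict_mono_on (set \<rho>) (snd \<circ> g)"
      "sorted_wrt (\<lambda>k l. fst (g k) < fst (g l)) \<rho>"
    and h: "h ` set \<tau> \<subseteq> B" "strict_mono_on (set \<tau>) (snd \<circ> h)"
      "sorted_wrt (\<lambda>k l. fst (h k) < fst (h l)) \<tau>"
    using assms(1,2) unfolding occurs_in_def by metis
  define e where "e k = (if k < f then g k else if k = f then m else h k)" for k
  have e_\<rho>: "e k = g k" "g k \<in> A" "k < f" if "k \<in> set \<rho>" for k
    using that assms(6) g(1) by (auto simp: e_def)
  have e_\<tau>: "e k = h k" "h k \<in> B" "f < k" if "k \<in> set \<tau>" for k
    using that assms(7) h(1) by (auto simp: e_def)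
  have e_f: "e f = m" by (simp add: e_def)
  have "e ` set (f # \<rho> @ \<tau>) \<subseteq> P"
    using e_\<rho> e_\<tau> e_f assms(3-5) by auto
  moreover have "strict_mono_on (set (f # \<rho> @ \<tau>)) (snd \<circ> e)"
  proof (rule strict_mono_onI)
    fix k l assume "k \<in> set (f # \<rho> @ \<tau>)" "l \<in> set (f # \<rho> @ \<tau>)" "k < l"
    moreover have "snd (g k) < snd (h l)" if "g k \<in> A" "h l \<in> B"
      using that assms(8,9) by fastforce
    ultimately show "(snd \<circ> e) k < (snd \<circ> e) l"
      using g(2) h(2) e_f assms(8,9) e_\<rho>[of k] e_\<rho>[of l] e_\<tau>[of k] e_\<tau>[of l]
      by (auto simp: strict_mono_on_def)
  qed
  moreover have "sorted_wrt (\<lambda>k l. fst (e k) < fst (e l)) (f # \<rho> @ \<tau>)"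
  proof -
    have "sorted_wrt (\<lambda>k l. fst (e k) < fst (e l)) \<rho>"
      using g(3) by (rule sorted_wrt_mono_rel[rotated]) (simp add: e_\<rho>)
    moreover have "sorted_wrt (\<lambda>k l. fst (e k) < fst (e l)) \<tau>"
      using h(3) by (rule sorted_wrt_mono_rel[rotated]) (simp add: e_\<tau>)
    ultimately show ?thesis
      using assms(8-10) by (auto simp: sorted_wrt_append e_\<rho> e_\<tau> e_f)
  qed
  ultimately show ?thesis unfolding occurs_in_def by blast
qed

text \<open>A point of \<open>B\<close> to the left of a point of \<open>A\<close> would form a 231
  with \<open>m\<close>. The boxes of \<open>A\<close> and \<open>B\<close> meet at the corner
  \<open>(x, snd m)\<close>, so their half-perimeters add up to at most that of the whole
  box.\<close>

lemma split_leftmost_point: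
  assumes "finite P" "P \<noteq> {}" "general_position P" "\<not> occurs_in [2, 3, 1] P"
    and "P \<subseteq> {x0..x1} \<times> {y0..y1}"
  obtains m A B x where "P = insert m (A \<union> B)" "m \<notin> A" "m \<notin> B"
    "\<forall>p\<in>A. fst m < fst p \<and> snd p < snd m" "\<forall>p\<in>B. fst m < fst p \<and> snd m < snd p"
    "\<forall>p\<in>A. \<forall>q\<in>B. fst p < fst q"
    "fst m \<le> x" "x \<le> x1" "A \<subseteq> {fst m..x} \<times> {y0..snd m}" "B \<subseteq> {x..x1} \<times> {snd m..y1}"
proof -
  obtain m where m: "m \<in> P" "\<forall>p\<in>P. fst m \<le> fst p"
    using ex_min_if_finite[of "fst ` P"] assms(1,2) by (auto simp: not_less)
  have m': "fst m < fst p" "snd p \<noteq> snd m" if "p \<in> P" "p \<noteq> m" for p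
    using that m assms(3) unfolding general_position_def by (metis order_le_less)+
  define A where "A = {p \<in> P. snd p < snd m}"
  define B where "B = {p \<in> P. snd m < snd p}"
  have P: "P = insert m (A \<union> B)" "m \<notin> A" "m \<notin> B"
    using m(1) m'(2) unfolding A_def B_def by force+
  have A: "\<forall>p\<in>A. fst m < fst p \<and> snd p < snd m"
    and B: "\<forall>p\<in>B. fst m < fst p \<and> snd m < snd p"
    using m'(1) unfolding A_def B_def by blast+
  have AB: "\<forall>p\<in>A. \<forall>q\<in>B. fst p < fst q"
  proof (intro ballI, rule ccontr)
    fix p q assume pq: "p \<in> A" "q \<in> B" "\<not> fst p < fst q"
    then have "p \<noteq> q" "p \<in> P" "q \<in> P" using A B P(1) by force+
    then have "fst q < fst p"
      using pq(3) assms(3) unfolding general_position_def by fastforce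
    then have "occurs_in [2, 3, 1] P"
      using A B pq(1,2) m(1) \<open>p \<in> P\<close> \<open>q \<in> P\<close> by (intro occurs_in_231[of m P q p]) auto
    then show False using assms(4) by blast
  qed
  \<comment> \<open>The right end of \<open>A\<close>. Inserting \<open>fst m\<close> covers empty
    \<open>A\<close>, whose box then has width zero.\<close>
  define x where "x = Max (insert (fst m) (fst ` A))"
  have fin: "finite (insert (fst m) (fst ` A))" using assms(1) unfolding A_def by simp
  have mx: "fst m \<le> x" and Ax: "\<And>p. p \<in> A \<Longrightarrow> fst p \<le> x"
    unfolding x_def using fin by auto
  have x_in: "x \<in> insert (fst m) (fst ` A)"
    unfolding x_def using fin by (intro Max_in) auto
  then have "x \<le> x1" using assms(5) P(1) by auto
  moreover have "x \<le> fst q" if "q \<in> B" for q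
    using x_in B AB that by (auto intro: less_imp_le)
  moreover have "p \<in> {x0..x1} \<times> {y0..y1}" if "p \<in> A \<union> B" for p
    using assms(5) P(1) that by blast
  ultimately have "A \<subseteq> {fst m..x} \<times> {y0..snd m}" "B \<subseteq> {x..x1} \<times> {snd m..y1}"
    using A B Ax by (fastforce simp: mem_Times_iff less_imp_le)+
  then show ?thesis using that[OF P A B AB mx \<open>x \<le> x1\<close>] by blast
qed

section \<open>Construction of the paths\<close>

text \<open>The pattern stays fixed while the point set shrinks; the bound for the shorter patterns
  enters as the assumption \<open>\<sigma>\<close>. \<open>W\<close> gathers the parts avoiding
  \<open>\<rho>\<close> or \<open>\<tau>\<close>, \<open>D\<close> the increasing chain and
  \<open>E\<close> the decreasing chain of split points. All connecting segments are monotone in the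
  direction of their path, so the costs telescope.\<close>

lemma connects_layers:
  fixes N :: real
  assumes "1 \<le> N" "\<forall>k\<in>set \<rho>. k < f" "\<forall>k\<in>set \<tau>. f < k"
    and \<sigma>: "\<And>\<sigma> Q x0 x1 y0 y1. \<lbrakk>\<sigma> \<in> {\<rho>, \<tau>}; finite Q; general_position Q;
      \<not> occurs_in [2, 3, 1] Q; \<not> occurs_in \<sigma> Q; Q \<subseteq> {x0..x1} \<times> {y0..y1}; x0 \<le> x1; y0 \<le> y1\<rbrakk>
      \<Longrightarrow> connects (x0, y0) (x1, y1) Q (N * ((x1 - x0) + (y1 - y0)))"
    and "finite P" "general_position P" "\<not> occurs_in [2, 3, 1] P" "\<not> occurs_in (f # \<rho> @ \<tau>) P"
    and "P \<subseteq> {x0..x1} \<times> {y0..y1}" "x0 \<le> x1" "y0 \<le> y1"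
  shows "\<exists>W D E. P \<subseteq> W \<union> D \<union> E \<and>
    connects (x0, y0) (x1, y1) W (N * ((x1 - x0) + (y1 - y0))) \<and>
    connects (x0, y0) (x1, y1) D ((x1 - x0) + (y1 - y0)) \<and>
    connects (x0, y1) (x1, y0) E ((x1 - x0) + (y1 - y0))"
  using assms(5-)
proof (induction "card P" arbitrary: P x0 x1 y0 y1 rule: less_induct)
  case less
  \<comment> \<open>Moves of the \<open>W\<close> path that collect nothing are charged at rate
    \<open>N\<close> too, which makes its total exactly \<open>N\<close> times the
    half-perimeter.\<close>
  have scale: "t \<le> N * t" if "0 \<le> t" for t
    using mult_right_mono[OF assms(1) that] by simp
  show ?case
  proof (cases "P = {}")
    case True
    have "dist (x0, y0) (x1, y1) \<le> (x1 - x0) + (y1 - y0)"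
      "dist (x0, y1) (x1, y0) \<le> (x1 - x0) + (y1 - y0)"
      using dist_Pair_le_abs[of x0 y0 x1 y1] dist_Pair_le_abs[of x0 y1 x1 y0] less.prems(6,7)
      by auto
    then have "connects (x0, y0) (x1, y1) {} ((x1 - x0) + (y1 - y0))"
      "connects (x0, y1) (x1, y0) {} ((x1 - x0) + (y1 - y0))"
      by (auto intro: connects_direct)
    moreover from this(1) have "connects (x0, y0) (x1, y1) {} (N * ((x1 - x0) + (y1 - y0)))"
      using scale[of "(x1 - x0) + (y1 - y0)"] less.prems(6,7) by (auto elim: connects_mono)
    ultimately show ?thesis using True by blast
  next
    case False
    obtain m A B x where P: "P = insert m (A \<union> B)" "m \<notin> A" "m \<notin> B"
      and A: "\<forall>p\<in>A. fst m < fst p \<and> snd p < snd m"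
      and B: "\<forall>p\<in>B. fst m < fst p \<and> snd m < snd p"
      and AB: "\<forall>p\<in>A. \<forall>q\<in>B. fst p < fst q"
      and x: "fst m \<le> x" "x \<le> x1"
      and boxes: "A \<subseteq> {fst m..x} \<times> {y0..snd m}" "B \<subseteq> {x..x1} \<times> {snd m..y1}"
      using split_leftmost_point[OF less.prems(1) False less.prems(2,3,5)] by metis
    obtain u v where m: "m = (u, v)" by fastforce
    have uv: "x0 \<le> u" "u \<le> x" "y0 \<le> v" "v \<le> y1"
      using P(1) m less.prems(5) x by auto
    have sub: "A \<subseteq> P" "B \<subseteq> P" "m \<in> P" using P(1) by auto
    have card: "card A < card P" "card B < card P"
      by (intro psubset_card_mono[OF less.prems(1)]; use P in blast)+
    have inherit: "finite Q" "general_position Q" "\<not> occurs_in [2, 3, 1] Q"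
      "\<not> occurs_in (f # \<rho> @ \<tau>) Q" if "Q \<subseteq> P" for Q
      using finite_subset[OF that less.prems(1)] general_position_subset[OF less.prems(2) that]
        occurs_in_mono[OF _ that] less.prems(3,4) by blast+
    have seg: "connects (a, b) (c, d) {} (\<bar>a - c\<bar> + \<bar>b - d\<bar>)" for a b c d :: real
      by (rule connects_direct[OF dist_Pair_le_abs])
    have boxA: "A \<subseteq> {u..x} \<times> {y0..v}" and boxB: "B \<subseteq> {x..x1} \<times> {v..y1}"
      using boxes m by auto
    have toA: "connects (x0, y0) (u, y0) {} (N * (u - x0))"
      using connects_mono[OF seg[of x0 y0 u y0]] scale[of "u - x0"] uv by simp
    show ?thesis
    proof (cases "occurs_in \<rho> A")
      \<comment> \<open>\<open>A\<close> is finished and \<open>B\<close> is split further.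
        \<open>m\<close> is level with the lower left corner \<open>(x, v)\<close> of the box of
        \<open>B\<close> and not to its right, so the increasing path visits it just before
        entering.\<close>
      case False
      have "connects (u, y0) (x, v) A (N * ((x - u) + (v - y0)))"
        using \<sigma>[OF _ inherit(1-3)[OF sub(1)] False boxA] uv by auto
      note pathA = connects_trans[OF toA this]
      obtain W D E where *: "B \<subseteq> W \<union> D \<union> E"
        "connects (x, v) (x1, y1) W (N * ((x1 - x) + (y1 - v)))"
        "connects (x, v) (x1, y1) D ((x1 - x) + (y1 - v))"
        "connects (x, y1) (x1, v) E ((x1 - x) + (y1 - v))"
        using less.hyps[OF card(2) inherit[OF sub(2)] boxB x(2) uv(4)] by blast
      have "connects (x0, y0) (x1, y1) (A \<union> W) (N * ((x1 - x0) + (y1 - y0)))"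
        using connects_trans[OF pathA *(2)]
        by (rule connects_mono) (auto simp: algebra_simps)
      moreover have "connects (x0, y0) (x1, y1) (insert m D) ((x1 - x0) + (y1 - y0))"
        using connects_trans[OF connects_trans[OF seg[of x0 y0 u v] seg[of u v x v]] *(3)]
        by (rule connects_mono) (use uv m in auto)
      moreover have "connects (x0, y1) (x1, y0) E ((x1 - x0) + (y1 - y0))"
        using connects_trans[OF connects_trans[OF seg[of x0 y1 x y1] *(4)] seg[of x1 v x1 y0]]
        by (rule connects_mono) (use uv in auto)
      moreover have "P \<subseteq> (A \<union> W) \<union> insert m D \<union> E" using P(1) *(1) by auto
      ultimately show ?thesis by blast
    next
      \<comment> \<open>\<open>B\<close> is finished and \<open>A\<close> is split further.
        \<open>m\<close> is the upper left corner of the box of \<open>A\<close>, where the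
        decreasing path enters.\<close>
      case True
      then have "\<not> occurs_in \<tau> B"
        using occurs_in_glue[OF True _ sub assms(2,3) A B AB] less.prems(4) by blast
      then have pathB: "connects (x, v) (x1, y1) B (N * ((x1 - x) + (y1 - v)))"
        using \<sigma>[OF _ inherit(1-3)[OF sub(2)] _ boxB] x(2) uv by auto
      obtain W D E where *: "A \<subseteq> W \<union> D \<union> E"
        "connects (u, y0) (x, v) W (N * ((x - u) + (v - y0)))"
        "connects (u, y0) (x, v) D ((x - u) + (v - y0))"
        "connects (u, v) (x, y0) E ((x - u) + (v - y0))"
        using less.hyps[OF card(1) inherit[OF sub(1)] boxA uv(2,3)] by blast
      have "connects (x0, y0) (x1, y1) (W \<union> B) (N * ((x1 - x0) + (y1 - y0)))"
        using connects_trans[OF connects_trans[OF toA *(2)] pathB]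
        by (rule connects_mono) (auto simp: algebra_simps)
      moreover have "connects (x0, y0) (x1, y1) D ((x1 - x0) + (y1 - y0))"
        using connects_trans[OF connects_trans[OF seg[of x0 y0 u y0] *(3)] seg[of x v x1 y1]]
        by (rule connects_mono) (use uv x(2) in auto)
      moreover have "connects (x0, y1) (x1, y0) (insert m E) ((x1 - x0) + (y1 - y0))"
        using connects_trans[OF connects_trans[OF seg[of x0 y1 u v] *(4)] seg[of x y0 x1 y0]]
        by (rule connects_mono) (use uv x(2) m in auto)
      moreover have "P \<subseteq> (W \<union> B) \<union> D \<union> insert m E" using P(1) *(1) by auto
      ultimately show ?thesis by blast
    qed
  qed
qed

text \<open>Induction on the length of the pattern. It is stated for \<open>distinct \<pi>\<close>
  because the pieces \<open>\<rho>\<close> and \<open>\<tau>\<close> inherit distinctness but need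
  not be permutations of an initial segment.\<close>

lemma connects_corners:
  assumes "distinct \<pi>" "avoids \<pi> [2, 3, 1]"
    and "finite P" "general_position P" "\<not> occurs_in [2, 3, 1] P" "\<not> occurs_in \<pi> P"
    and "P \<subseteq> {x0..x1} \<times> {y0..y1}" "x0 \<le> x1" "y0 \<le> y1"
  shows "connects (x0, y0) (x1, y1) P (4 * real (length \<pi>) * ((x1 - x0) + (y1 - y0)))"
  using assms
proof (induction "length \<pi>" arbitrary: \<pi> P x0 x1 y0 y1 rule: less_induct)
  case less
  let ?s = "(x1 - x0) + (y1 - y0)"
  \<comment> \<open>The empty pattern occurs in every set.\<close>
  have "\<pi> \<noteq> []" using less.prems(6) unfolding occurs_in_def by auto
  then obtain f \<sigma> where \<pi>: "\<pi> = f # \<sigma>" by (cases \<pi>) auto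
  have s: "0 \<le> ?s" using less.prems(8,9) by simp
  have seg: "connects (a, b) (c, d) {} (\<bar>a - c\<bar> + \<bar>b - d\<bar>)" for a b c d :: real
    by (rule connects_direct[OF dist_Pair_le_abs])
  show ?case
  proof (cases "P = {}")
    case True
    have "?s \<le> 4 * real (length \<pi>) * ?s"
      using mult_right_mono[OF _ s, of 1 "4 * real (length \<pi>)"] by (simp add: \<pi>)
    then show ?thesis
      using connects_mono[OF seg[of x0 y0 x1 y1]] True less.prems(8,9) by simp
  next
    case False
    obtain \<rho> \<tau> where \<sigma>: "\<sigma> = \<rho> @ \<tau>" "\<forall>k\<in>set \<rho>. k < f" "\<forall>k\<in>set \<tau>. f < k"
      using avoids_231_split_first less.prems(1,2) unfolding \<pi> by metis
    \<comment> \<open>A single entry occurs in any nonempty set, so \<open>\<pi>\<close> has at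
      least two entries; this yields \<open>1 \<le> N\<close>.\<close>
    obtain p where "p \<in> P" using False by blast
    then have "occurs_in [f] P"
      unfolding occurs_in_def by (intro exI[of _ "\<lambda>_. p"]) (auto simp: strict_mono_on_def)
    then have "\<sigma> \<noteq> []" using less.prems(6) \<pi> by auto
    define N where "N = 4 * real (length \<sigma>)"
    have "1 \<le> N" using \<open>\<sigma> \<noteq> []\<close> unfolding N_def by (cases \<sigma>) auto
    have part: "connects (x0, y0) (x1, y1) Q (N * ((x1 - x0) + (y1 - y0)))"
      if "\<sigma>' \<in> {\<rho>, \<tau>}" "finite Q" "general_position Q" "\<not> occurs_in [2, 3, 1] Q"
        "\<not> occurs_in \<sigma>' Q" "Q \<subseteq> {x0..x1} \<times> {y0..y1}" "x0 \<le> x1" "y0 \<le> y1"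
      for \<sigma>' Q x0 x1 y0 y1
    proof -
      have "subseq \<sigma>' \<pi>" "length \<sigma>' < length \<pi>" "4 * real (length \<sigma>') \<le> N" "distinct \<sigma>'"
        using that(1) less.prems(1) unfolding \<pi> \<sigma>(1) N_def by auto
      then have "connects (x0, y0) (x1, y1) Q (4 * real (length \<sigma>') * ((x1 - x0) + (y1 - y0)))"
        using less.hyps that less.prems(2) avoids_subseq by blast
      then show ?thesis
        using \<open>4 * real (length \<sigma>') \<le> N\<close> that(7,8)
        by (elim connects_mono) (auto intro!: mult_right_mono)
    qed
    obtain W D E where WDE: "P \<subseteq> W \<union> D \<union> E" "connects (x0, y0) (x1, y1) W (N * ?s)"
      "connects (x0, y0) (x1, y1) D ?s" "connects (x0, y1) (x1, y0) E ?s"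
    proof (atomize_elim, rule connects_layers[OF \<open>1 \<le> N\<close> \<sigma>(2,3)])
      show "\<not> occurs_in (f # \<rho> @ \<tau>) P" using less.prems(6) \<pi> \<sigma>(1) by simp
    qed (use part less.prems in blast)+
    \<comment> \<open>A closed loop: up along \<open>D\<close>, left along the top side, down along
      \<open>E\<close>, back along the bottom side. Each of the four pieces costs at most
      \<open>?s\<close>. The \<open>W\<close> path follows, and \<open>N + 4\<close> is
      \<open>4 * length \<pi>\<close>.\<close>
    have "connects (x0, y0) (x0, y0) (D \<union> E) (4 * ?s)"
      using connects_trans[OF connects_trans[OF WDE(3) seg[of x1 y1 x0 y1]]
          connects_trans[OF WDE(4) seg[of x1 y0 x0 y0]]]
      by (rule connects_mono) (use less.prems(8,9) in auto)
    from connects_trans[OF this WDE(2)] show ?thesis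
      by (rule connects_mono) (use WDE(1) in \<open>auto simp: N_def \<pi> algebra_simps\<close>)
  qed
qed

theorem theorem3p17:
  fixes \<pi> :: "nat list" and P :: "(real \<times> real) set"
  assumes "is_permutation \<pi>"
    and "avoids \<pi> [2, 3, 1]"
    and "finite P"
    and "P \<subseteq> {0..1} \<times> {0..1}"
    and "general_position P"
    and "set_avoids P [2, 3, 1]"
    and "set_avoids P \<pi>"
  shows "TSP P \<le> 12 * real (length \<pi>)"
proof -
  have "distinct \<pi>"
    using assms(1) unfolding is_permutation_def permutations_of_set_def by simp
  moreover have no: "\<not> occurs_in [2, 3, 1] P" "\<not> occurs_in \<pi> P"
    using not_set_avoids_if_occurs_in[OF assms(3,5)] assms(6,7) by blast+
  ultimately have path: "connects (0, 0) (1, 1) P (4 * real (length \<pi>) * ((1 - 0) + (1 - 0)))"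
    using assms(2-5) by (intro connects_corners) auto
  \<comment> \<open>The unit square has half-perimeter 2, so the path costs
    \<open>8 * length \<pi>\<close>. Returning to the origin adds at most 2, which is absorbed since
    \<open>\<pi>\<close> is nonempty.\<close>
  have "connects (1 :: real, 1 :: real) (0, 0) {} 2"
    using dist_Pair_le_abs[of 1 1 0 0] by (auto intro!: connects_direct)
  from connects_trans[OF path this] have "connects (0, 0) (0, 0) P (8 * real (length \<pi>) + 2)"
    by (rule connects_mono) auto
  then have "TSP P \<le> 8 * real (length \<pi>) + 2"
    by (rule TSP_le_connects[OF assms(3)])
  moreover have "\<pi> \<noteq> []" using no(2) unfolding occurs_in_def by auto
  then have "1 \<le> real (length \<pi>)" by (cases \<pi>) auto
  ultimately show ?thesis by linarith
qed

end
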